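(* Let $G$ be a $T_0$ strongly topological gyrogroup with symmetric neighborhood base $\mathscr U$ at $0$. If $G$ is of countable pseudocharacter, then $G$ is submetrizable.
   Context: A gyrogroup is a nonempty set $G$ with a binary operation $\oplus$ such that: (G1) there is a unique identity element $0\in G$ with $0\oplus a=a=a\oplus 0$ for all $a\in G$; (G2) for each $x\in G$ there is a unique inverse $\ominus x\in G$ with $\ominus x\oplus x=0=x\oplus(\ominus x)$; (G3) for all $x,y\in G$ there is a bijective homomorphism $\mathrm{gyr}[x,y]$ of $(G,\oplus)$ onto itself such that $x\oplus(y\oplus z)=(x\oplus y)\oplus \mathrm{gyr}[x,y](z)$ for all $z\in G$; (G4) $\mathrm{gyr}[x\oplus y,y]=\mathrm{gyr}[x,y]$ for all $x,y\in G$. A topological gyrogroup is a gyrogroup $(G,\oplus)$ with a topology such that $\oplus:G\times G\to G$ is (jointly) continuous and $x\mapsto\ominus x$ is continuous. A strongly topological gyrogroup with symmetric neighborhood base $\mathscr U$ at $0$ is a topological gyrogroup $G$ together with a neighborhood base $\mathscr U$ of $0$, consisting of open symmetric sets ($\ominus U=U$), such that $\mathrm{gyr}[x,y](U)=U$ for every $U\in\mathscr U$ and all $x,y\in G$. A space $X$ is of countable pseudocharacter if for every $x\in X$ there is a sequence of open sets $\{U_n(x)\}_{n\in\mathbb N}$ with $\{x\}=\bigcap_{n\in\mathbb N}U_n(x)$. A space $X$ is submetrizable if there is a continuous one-to-one mapping of $X$ onto a metrizable space. *)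

theory Defs
  imports "HOL-Analysis.Analysis"
begin

text \<open>The maps \<open>ominus\<close> and \<open>gyr x y\<close> are constrained only on the carrier, where the axioms
  determine them uniquely from the operation.\<close>

locale gyrogroup =
  fixes G :: "'a set"
    and oplus :: "'a \<Rightarrow> 'a \<Rightarrow> 'a" (infixl "\<oplus>" 65)
    and zero :: 'a
    and ominus :: "'a \<Rightarrow> 'a"
    and gyr :: "'a \<Rightarrow> 'a \<Rightarrow> 'a \<Rightarrow> 'a"
  assumes oplus_closed: "\<lbrakk>x \<in> G; y \<in> G\<rbrakk> \<Longrightarrow> x \<oplus> y \<in> G"
    and zero_closed: "zero \<in> G"
    and zero_identity: "a \<in> G \<Longrightarrow> zero \<oplus> a = a \<and> a \<oplus> zero = a"
    and zero_unique:
      "\<lbrakk>e \<in> G; \<forall>a\<in>G. e \<oplus> a = a \<and> a \<oplus> e = a\<rbrakk> \<Longrightarrow> e = zero"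
    and ominus_closed: "x \<in> G \<Longrightarrow> ominus x \<in> G"
    and ominus_inverse: "x \<in> G \<Longrightarrow> ominus x \<oplus> x = zero \<and> x \<oplus> ominus x = zero"
    and ominus_unique:
      "\<lbrakk>x \<in> G; y \<in> G; y \<oplus> x = zero; x \<oplus> y = zero\<rbrakk> \<Longrightarrow> y = ominus x"
    and gyr_bij: "\<lbrakk>x \<in> G; y \<in> G\<rbrakk> \<Longrightarrow> bij_betw (gyr x y) G G"
    and gyr_hom: "\<lbrakk>x \<in> G; y \<in> G; a \<in> G; b \<in> G\<rbrakk> \<Longrightarrow>
      gyr x y (a \<oplus> b) = gyr x y a \<oplus> gyr x y b"
    and gyr_assoc: "\<lbrakk>x \<in> G; y \<in> G; z \<in> G\<rbrakk> \<Longrightarrow>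
      x \<oplus> (y \<oplus> z) = (x \<oplus> y) \<oplus> gyr x y z"
    and gyr_loop: "\<lbrakk>x \<in> G; y \<in> G; z \<in> G\<rbrakk> \<Longrightarrow> gyr (x \<oplus> y) y z = gyr x y z"

locale topological_gyrogroup =
  gyrogroup "topspace X" oplus zero ominus gyr
  for X :: "'a topology"
    and oplus :: "'a \<Rightarrow> 'a \<Rightarrow> 'a" (infixl "\<oplus>" 65)
    and zero :: 'a
    and ominus :: "'a \<Rightarrow> 'a"
    and gyr :: "'a \<Rightarrow> 'a \<Rightarrow> 'a \<Rightarrow> 'a" +
  assumes continuous_oplus: "continuous_map (prod_topology X X) X (\<lambda>(x, y). x \<oplus> y)"
    and continuous_ominus: "continuous_map X X ominus"

locale strongly_topological_gyrogroup =
  topological_gyrogroup X oplus zero ominus gyr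
  for X :: "'a topology"
    and oplus :: "'a \<Rightarrow> 'a \<Rightarrow> 'a" (infixl "\<oplus>" 65)
    and zero :: 'a
    and ominus :: "'a \<Rightarrow> 'a"
    and gyr :: "'a \<Rightarrow> 'a \<Rightarrow> 'a \<Rightarrow> 'a" +
  fixes \<U> :: "'a set set"
  assumes base_open: "U \<in> \<U> \<Longrightarrow> openin X U"
    and base_zero: "U \<in> \<U> \<Longrightarrow> zero \<in> U"
    and base_refines: "\<lbrakk>openin X V; zero \<in> V\<rbrakk> \<Longrightarrow> \<exists>U\<in>\<U>. U \<subseteq> V"
    and base_symmetric: "U \<in> \<U> \<Longrightarrow> ominus ` U = U"
    and base_gyr_invariant:
      "\<lbrakk>U \<in> \<U>; x \<in> topspace X; y \<in> topspace X\<rbrakk> \<Longrightarrow> gyr x y ` U = U"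

definition countable_pseudocharacter :: "'a topology \<Rightarrow> bool" where
  "countable_pseudocharacter X \<longleftrightarrow>
     (\<forall>x\<in>topspace X. \<exists>U :: nat \<Rightarrow> 'a set. (\<forall>n. openin X (U n)) \<and> (\<Inter>n. U n) = {x})"

text \<open>The metrizable space may be taken over the same type as \<open>X\<close>, since the mapping is a
  bijection of point sets; \<open>submetrizable_spaceI\<close> shows that this is no restriction.\<close>

definition submetrizable_space :: "'a topology \<Rightarrow> bool" where
  "submetrizable_space X \<longleftrightarrow>
     (\<exists>(Y :: 'a topology) f. metrizable_space Y \<and> continuous_map X Y f \<and>
        inj_on f (topspace X) \<and> f ` topspace X = topspace Y)"

lemma submetrizable_spaceI:
  fixes X :: "'a topology" and Y :: "'b topology"
  assumes Y: "metrizable_space Y" and f: "continuous_map X Y f"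
    and inj: "inj_on f (topspace X)" and surj: "f ` topspace X = topspace Y"
  shows "submetrizable_space X"
proof -
  define Z where "Z = pullback_topology (topspace X) f Y"
  have top: "topspace Z = topspace X"
    using surj by (auto simp: Z_def topspace_pullback_topology)
  have cont: "continuous_map X Z id"
    unfolding Z_def using f by (intro continuous_map_pullback') auto
  have fZ: "continuous_map Z Y f"
    unfolding Z_def using continuous_map_pullback[of Y Y id "topspace X" f] by simp
  have "open_map Z Y f"
    unfolding open_map_def
  proof (intro allI impI)
    fix S assume "openin Z S"
    then obtain U where U: "openin Y U" "S = f -` U \<inter> topspace X"
      by (auto simp: Z_def openin_pullback_topology)
    then have "f ` S = U"
      using openin_subset[OF U(1)] by (auto simp flip: surj)
    with U show "openin Y (f ` S)" by simp
  qed
  then have "homeomorphic_map Z Y f"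
    using fZ inj surj top by (intro bijective_open_imp_homeomorphic_map) auto
  then have "metrizable_space Z"
    using Y homeomorphic_map_imp_homeomorphic_space homeomorphic_metrizable_space by blast
  with cont top show ?thesis
    unfolding submetrizable_space_def by (intro exI[of _ Z] exI[of _ id]) auto
qed

end

theory Submission
  imports Defs
begin

text \<open>Choose \<open>U n \<in> \<U>\<close> shrinking to \<open>{0}\<close> with \<open>U (n + 1) \<oplus> (U (n + 1) \<oplus> U (n + 1)) \<subseteq> U n\<close>.
  The relations \<open>\<ominus>x \<oplus> y \<in> U n\<close> are symmetric and compose well, because
  \<open>\<ominus>x \<oplus> z = (\<ominus>x \<oplus> y) \<oplus> gyr[\<ominus>x, y](\<ominus>y \<oplus> z)\<close> and \<open>U n\<close> is invariant under gyrations.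
  They therefore form a countable base of a separated uniformity, which is metrizable by the
  chain construction of Frink and Weil, and its topology is coarser than the given one.\<close>

section \<open>Metrization of a countable base of a uniformity\<close>

text \<open>The step count is an index because the lower bound on chain sums is proved by strong
  induction on it. The sum \<open>s\<close> is an argument so that a distance can later be defined
  as the infimum of all sums between two points.\<close>

inductive chain :: "('a \<Rightarrow> 'a \<Rightarrow> real) \<Rightarrow> nat \<Rightarrow> 'a \<Rightarrow> 'a \<Rightarrow> real \<Rightarrow> bool"
  for f :: "'a \<Rightarrow> 'a \<Rightarrow> real" where
  chain_refl: "chain f 0 x x 0"
| chain_step: "chain f n y z s \<Longrightarrow> chain f (Suc n) x z (f x y + s)"

lemma chain_single: "chain f (Suc 0) x y (f x y)"
  using chain_step[OF chain_refl] by fastforce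

lemma chain_trans:
  assumes "chain f m x y s" "chain f n y z t"
  shows "chain f (m + n) x z (s + t)"
  using assms
proof (induction rule: chain.induct)
  case (chain_step m y w s x)
  then show ?case
    using chain.chain_step[of f "m + n" y z "s + t" x] by (simp add: add.assoc)
qed simp

lemma chain_sym:
  assumes "chain f n x y s" and "\<And>x y. f x y = f y x"
  shows "chain f n y x s"
  using assms(1)
proof (induction rule: chain.induct)
  case (chain_step n y z s x)
  then have "chain f (n + Suc 0) z x (s + f y x)"
    by (blast intro: chain_trans chain_single)
  then show ?case
    using assms(2)[of x y] by (simp add: add.commute)
qed (rule chain_refl)

lemma chain_nonneg:
  assumes "chain f n x y s" and "\<And>x y. 0 \<le> f x y"
  shows "0 \<le> s"
  using assms(1) by (induction rule: chain.induct) (auto simp: assms(2))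

text \<open>Walk along the chain until the next step would push the partial sum above
  \<open>r\<close>, or until only the last step is left; that step is \<open>(a, b)\<close>. What
  precedes it costs at most \<open>r\<close>. What follows costs at most \<open>t\<close>, since it
  is either empty or the remainder after more than \<open>r\<close> of at most \<open>r + t\<close>
  has been spent. In the induction \<open>r\<close> shrinks by each step passed.\<close>

lemma chain_split:
  assumes "chain f n x z s" and "n > 0" and "\<And>x y. 0 \<le> f x y"
    and "0 \<le> r" "0 \<le> t" "s \<le> r + t"
  shows "\<exists>a b n1 n2 s1 s2. chain f n1 x a s1 \<and> chain f n2 b z s2 \<and> n = Suc (n1 + n2) \<and>
           s = s1 + f a b + s2 \<and> s1 \<le> r \<and> s2 \<le> t"
  using assms(1,2,4-)
proof (induction arbitrary: r rule: chain.induct)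
  case (chain_step n y z s x)
  show ?case
  proof (cases "n = 0 \<or> r < f x y")
    case True
    have "s \<le> t"
    proof (cases "n = 0")
      case True
      with chain_step.hyps have "s = 0" by (cases rule: chain.cases) auto
      with chain_step.prems show ?thesis by simp
    qed (use True chain_step.prems in linarith)
    then show ?thesis
      using chain_step.hyps chain_step.prems
      by (intro exI[of _ x] exI[of _ y] exI[of _ 0] exI[of _ n] exI[of _ "0::real"] exI[of _ s])
         (simp add: chain_refl)
  next
    case False
    with chain_step.IH[of "r - f x y"] chain_step.prems
    obtain a b n1 n2 s1 s2 where *: "chain f n1 y a s1" "chain f n2 b z s2" "n = Suc (n1 + n2)"
      "s = s1 + f a b + s2" "s1 \<le> r - f x y" "s2 \<le> t"
      by auto
    then have "chain f (Suc n1) x a (f x y + s1)"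
      by (blast intro: chain.chain_step)
    with * show ?thesis
      by (intro exI[of _ a] exI[of _ b] exI[of _ "Suc n1"] exI[of _ n2]
            exI[of _ "f x y + s1"] exI[of _ s2]) simp
  qed
qed simp

text \<open>Frink's lemma. Cutting the chain at half its sum leaves two shorter outer chains of sum
  at most \<open>s / 2\<close>, whose endpoints are by induction at \<open>f\<close>-distance at
  most \<open>s\<close>. The middle step is a summand of \<open>s\<close>, so it is also at most
  \<open>s\<close>, and \<open>triple\<close> joins the three pieces at the cost of a single factor
  2.\<close>

lemma chain_lower_bound:
  assumes "chain f n x y s"
    and nonneg: "\<And>x y. 0 \<le> f x y" and refl: "\<And>x. f x x = 0"
    and triple: "\<And>w x y z r. f w x \<le> r \<Longrightarrow> f x y \<le> r \<Longrightarrow> f y z \<le> r \<Longrightarrow> f w z \<le> 2 * r"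
  shows "f x y \<le> 2 * s"
  using assms(1)
proof (induction n arbitrary: x y s rule: less_induct)
  case (less n)
  show ?case
  proof (cases "n = 0")
    case True
    with less.prems show ?thesis
      by (cases rule: chain.cases) (auto simp: refl)
  next
    case False
    have "0 \<le> s"
      using less.prems nonneg by (rule chain_nonneg)
    then obtain a b n1 n2 s1 s2 where *: "chain f n1 x a s1" "chain f n2 b y s2"
      "n = Suc (n1 + n2)" "s = s1 + f a b + s2" "s1 \<le> s / 2" "s2 \<le> s / 2"
      using chain_split[OF less.prems, of "s / 2" "s / 2"] False nonneg by auto
    have "f x a \<le> 2 * s1" "f b y \<le> 2 * s2"
      using less.IH[OF _ *(1)] less.IH[OF _ *(2)] *(3) by simp_all
    moreover have "0 \<le> s1" "0 \<le> s2"
      using chain_nonneg[OF *(1) nonneg] chain_nonneg[OF *(2) nonneg] by simp_all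
    ultimately have "f x a \<le> s" "f a b \<le> s" "f b y \<le> s"
      using *(4-6) by linarith+
    then show ?thesis
      by (rule triple)
  qed
qed

text \<open>The levels \<open>V n\<close> give a dyadic gauge \<open>f\<close> that may violate the
  triangle inequality. The infimum \<open>d\<close> of chain sums restores it, and Frink's lemma
  keeps \<open>d\<close> between \<open>f / 2\<close> and \<open>f\<close>, so \<open>d\<close>
  still measures the levels.\<close>

lemma uniformity_metrization:
  fixes V :: "nat \<Rightarrow> 'a rel"
  assumes refl: "\<And>n x. (x, x) \<in> V n"
    and sym: "\<And>n. sym (V n)"
    and comp: "\<And>n. V (Suc n) O V (Suc n) O V (Suc n) \<subseteq> V n"
    and sep: "(\<Inter>n. V n) = Id"
  obtains d where "Metric_space UNIV d"
    and "\<And>n x y. (x, y) \<in> V n \<Longrightarrow> d x y < (1/2) ^ n"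
    and "\<And>n x y. d x y < (1/2) ^ Suc n \<Longrightarrow> (x, y) \<in> V n"
proof -
  \<comment> \<open>The exponent is the first level that omits the pair; it exists off the diagonal
    by \<open>sep\<close>. As the levels decrease, \<open>f x y < (1/2) ^ n\<close> will mean
    exactly \<open>(x, y) \<in> V n\<close>.\<close>
  define f :: "'a \<Rightarrow> 'a \<Rightarrow> real" where
    "f x y = (if x = y then 0 else (1/2) ^ (LEAST n. (x, y) \<notin> V n))" for x y
  define d where "d x y = Inf {s. \<exists>n. chain f n x y s}" for x y
  \<comment> \<open>Padding a pair with two diagonal pairs turns \<open>comp\<close> into
    monotonicity.\<close>
  have "V (Suc n) \<subseteq> V n" for n
    by (meson comp refl relcompI subrelI subsetD)
  then have anti: "V n \<subseteq> V m" if "m \<le> n" for m n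
    using that by (rule lift_Suc_antimono_le)
  have f_less: "f x y < (1/2) ^ n \<longleftrightarrow> (x, y) \<in> V n" for x y n
  proof (cases "x = y")
    case False
    define k where "k = (LEAST n. (x, y) \<notin> V n)"
    have "\<exists>n. (x, y) \<notin> V n"
      using False sep by blast
    then have "(x, y) \<notin> V k"
      unfolding k_def by (rule LeastI_ex)
    moreover have "(x, y) \<in> V m" if "m < k" for m
      using not_less_Least[OF that[unfolded k_def]] by blast
    ultimately have "(x, y) \<in> V n \<longleftrightarrow> n < k"
      using anti[of k n] by (meson not_le subsetD)
    then show ?thesis
      using False by (simp add: f_def k_def power_strict_decreasing_iff)
  qed (simp add: f_def refl)
  have nonneg: "0 \<le> f x y" for x y
    by (simp add: f_def)
  have f_refl: "f x x = 0" for x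
    by (simp add: f_def)
  have f_sym: "f x y = f y x" for x y
  proof -
    have "(x, y) \<in> V n \<longleftrightarrow> (y, x) \<in> V n" for n
      using sym[of n] by (auto dest: symD)
    then show ?thesis
      by (auto simp: f_def)
  qed
  have triple: "f w z \<le> 2 * r" if "f w x \<le> r" "f x y \<le> r" "f y z \<le> r" for w x y z r
  proof (rule ccontr)
    assume "\<not> f w z \<le> 2 * r"
    moreover have "0 \<le> r"
      using that(1) nonneg[of w x] by linarith
    \<comment> \<open>The nonzero values of \<open>f\<close> are powers of 1/2, so a violated bound
      puts \<open>r\<close> below the next smaller power, and all three pairs lie one level
      deeper.\<close>
    ultimately obtain n where n: "f w z = (1/2) ^ n" "2 * r < (1/2) ^ n"
      by (auto simp: f_def split: if_splits)
    then have "r < (1/2) ^ Suc n"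
      by simp
    then have "(w, x) \<in> V (Suc n)" "(x, y) \<in> V (Suc n)" "(y, z) \<in> V (Suc n)"
      using that by (auto simp flip: f_less)
    then have "(w, z) \<in> V n"
      using comp by (meson relcompI subsetD)
    then show False
      using n by (simp flip: f_less)
  qed
  have lower: "f x y / 2 \<le> s" if "chain f n x y s" for x y n s
    using chain_lower_bound[OF that nonneg f_refl] triple by fastforce
  have bdd: "bdd_below {s. \<exists>n. chain f n x y s}" for x y
    using lower by (intro bdd_belowI[of _ "f x y / 2"]) blast
  have ne: "{s. \<exists>n. chain f n x y s} \<noteq> {}" for x y
    using chain_single[of f x y] by blast
  have d_le: "d x y \<le> s" if "chain f n x y s" for x y n s
    unfolding d_def using that by (intro cInf_lower bdd) blast
  have d_le_f: "d x y \<le> f x y" for x y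
    by (rule d_le[OF chain_single])
  have d_ge: "f x y / 2 \<le> d x y" for x y
    unfolding d_def using lower by (intro cInf_greatest ne) blast
  have d_sym: "d x y = d y x" for x y
  proof -
    have "chain f n b a s" if "chain f n a b s" for n a b s
      using that f_sym by (rule chain_sym)
    then have "{s. \<exists>n. chain f n x y s} = {s. \<exists>n. chain f n y x s}"
      by blast
    then show ?thesis
      by (simp add: d_def)
  qed
  have d_triangle: "d x z \<le> d x y + d y z" for x y z
  proof (rule field_le_epsilon)
    fix e :: real
    assume "0 < e"
    then have near: "\<exists>n s. chain f n a b s \<and> s < d a b + e / 2" for a b
      using cInf_lessD[OF ne[of a b], of "d a b + e / 2"] by (auto simp: d_def)
    obtain m s n t where "chain f m x y s" "s < d x y + e / 2"
      "chain f n y z t" "t < d y z + e / 2"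
      using near[of x y] near[of y z] by auto
    then show "d x z \<le> d x y + d y z + e"
      using d_le[OF chain_trans] by fastforce
  qed
  \<comment> \<open>The factor 2 lost in \<open>d_ge\<close> costs one level.\<close>
  have small: "(x, y) \<in> V n" if "d x y < (1/2) ^ Suc n" for x y n
    using that d_ge[of x y] by (simp flip: f_less)
  have "Metric_space UNIV d"
  proof
    show "0 \<le> d x y" for x y
      using d_ge[of x y] nonneg[of x y] by linarith
    show "d x y = 0 \<longleftrightarrow> x = y" for x y
    proof
      show "x = y" if "d x y = 0"
        using small[of x y] that sep by auto
      show "d x y = 0" if "x = y"
        using that d_le_f[of x x] d_ge[of x x] f_refl[of x] by simp
    qed
  qed (rule d_sym d_triangle)+
  moreover have "d x y < (1/2) ^ n" if "(x, y) \<in> V n" for x y n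
    using that d_le_f[of x y] by (simp flip: f_less)
  ultimately show thesis
    using small that by blast
qed

section \<open>Gyrogroups\<close>

context gyrogroup
begin

lemma gyr_closed: "\<lbrakk>x \<in> G; y \<in> G; z \<in> G\<rbrakk> \<Longrightarrow> gyr x y z \<in> G"
  using gyr_bij bij_betwE by blast

text \<open>Gyroassociativity rewrites \<open>ominus a \<oplus> (a \<oplus> x)\<close> as
  \<open>gyr (ominus a) a x\<close>, and gyrations are injective.\<close>

lemma oplus_left_cancel:
  assumes "a \<in> G" "b \<in> G" "c \<in> G" "a \<oplus> b = a \<oplus> c"
  shows "b = c"
proof -
  have "gyr (ominus a) a x = ominus a \<oplus> (a \<oplus> x)" if "x \<in> G" for x
    using assms(1) that
    by (simp add: gyr_assoc ominus_closed ominus_inverse zero_identity gyr_closed)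
  then have "gyr (ominus a) a b = gyr (ominus a) a c"
    using assms by simp
  then show ?thesis
    using gyr_bij[of "ominus a" a] assms ominus_closed
    by (auto simp: bij_betw_def dest: inj_onD)
qed

lemma gyr_zero_left:
  assumes "x \<in> G" "z \<in> G"
  shows "gyr zero x z = z"
proof (rule oplus_left_cancel[of x])
  show "x \<oplus> gyr zero x z = x \<oplus> z"
    using gyr_assoc[of zero x z] assms by (simp add: zero_closed zero_identity oplus_closed)
qed (use assms in \<open>auto intro: gyr_closed zero_closed\<close>)

text \<open>The loop property identifies \<open>gyr (ominus a) a\<close> with
  \<open>gyr zero a\<close>, which is the identity.\<close>

lemma ominus_oplus_cancel:
  assumes "a \<in> G" "b \<in> G"
  shows "ominus a \<oplus> (a \<oplus> b) = b"
proof -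
  have "gyr (ominus a) a b = b"
    using gyr_loop[of "ominus a" a b] assms
    by (simp add: ominus_closed ominus_inverse gyr_zero_left)
  then show ?thesis
    using gyr_assoc[of "ominus a" a b] assms
    by (simp add: ominus_closed ominus_inverse zero_identity)
qed

lemma ominus_ominus: "a \<in> G \<Longrightarrow> ominus (ominus a) = a"
  using ominus_unique[of "ominus a" a] ominus_closed ominus_inverse by simp

lemma oplus_ominus_cancel:
  assumes "a \<in> G" "b \<in> G"
  shows "a \<oplus> (ominus a \<oplus> b) = b"
  using ominus_oplus_cancel[of "ominus a" b] assms by (simp add: ominus_closed ominus_ominus)

text \<open>The gyrogroup form of the telescoping law for left differences: the second difference
  enters only after a gyration, which invariant neighborhoods absorb.\<close>

lemma ominus_oplus_trans:
  assumes "x \<in> G" "y \<in> G" "z \<in> G"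
  shows "(ominus x \<oplus> y) \<oplus> gyr (ominus x) y (ominus y \<oplus> z) = ominus x \<oplus> z"
  using gyr_assoc[of "ominus x" y "ominus y \<oplus> z"] assms
  by (simp add: ominus_closed oplus_closed oplus_ominus_cancel)

text \<open>By telescoping from \<open>x\<close> through \<open>y\<close> back to \<open>x\<close>,
  the right-hand side is also a right inverse of \<open>ominus x \<oplus> y\<close>; left
  cancellation finishes.\<close>

lemma ominus_ominus_oplus:
  assumes "x \<in> G" "y \<in> G"
  shows "ominus (ominus x \<oplus> y) = gyr (ominus x) y (ominus y \<oplus> x)"
proof (rule oplus_left_cancel[of "ominus x \<oplus> y"])
  show "(ominus x \<oplus> y) \<oplus> ominus (ominus x \<oplus> y)
      = (ominus x \<oplus> y) \<oplus> gyr (ominus x) y (ominus y \<oplus> x)"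
    using assms by (simp add: ominus_oplus_trans ominus_inverse oplus_closed ominus_closed)
qed (use assms in \<open>auto intro!: gyr_closed oplus_closed ominus_closed\<close>)

lemma ominus_oplus_eq_zero_iff:
  assumes "x \<in> G" "y \<in> G"
  shows "ominus x \<oplus> y = zero \<longleftrightarrow> x = y"
proof
  assume "ominus x \<oplus> y = zero"
  then show "x = y"
    using oplus_ominus_cancel[OF assms] assms by (simp add: zero_identity)
qed (use assms in \<open>simp add: ominus_inverse\<close>)

end

section \<open>Strongly topological gyrogroups\<close>

context strongly_topological_gyrogroup
begin

lemma base_gyr_closed:
  "\<lbrakk>U \<in> \<U>; x \<in> topspace X; y \<in> topspace X; u \<in> U\<rbrakk> \<Longrightarrow> gyr x y u \<in> U"
  using base_gyr_invariant by blast

lemma base_oplus_refines: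
  assumes "openin X W" "zero \<in> W"
  obtains U where "U \<in> \<U>" "\<And>u v. \<lbrakk>u \<in> U; v \<in> U\<rbrakk> \<Longrightarrow> u \<oplus> v \<in> W"
proof -
  let ?P = "{p \<in> topspace (prod_topology X X). (case p of (x, y) \<Rightarrow> x \<oplus> y) \<in> W}"
  have "openin (prod_topology X X) ?P"
    using continuous_oplus assms(1) by (rule openin_continuous_map_preimage)
  moreover have "(zero, zero) \<in> ?P"
    using assms(2) zero_closed zero_identity by simp
  ultimately obtain A B where AB: "openin X A" "openin X B" "zero \<in> A" "zero \<in> B" "A \<times> B \<subseteq> ?P"
    unfolding openin_prod_topology_alt by meson
  then obtain U where "U \<in> \<U>" "U \<subseteq> A \<inter> B"
    using base_refines[of "A \<inter> B"] by (auto simp: openin_Int)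
  show thesis
  proof (rule that[OF \<open>U \<in> \<U>\<close>])
    fix u v
    assume "u \<in> U" "v \<in> U"
    with \<open>U \<subseteq> A \<inter> B\<close> have "(u, v) \<in> A \<times> B"
      by blast
    then have "(u, v) \<in> ?P"
      using AB(5) by (rule subsetD[rotated])
    then show "u \<oplus> v \<in> W"
      by simp
  qed
qed

lemma base_oplus_refines3:
  assumes "openin X W" "zero \<in> W"
  obtains U where "U \<in> \<U>" "U \<subseteq> W" "\<And>u v w. \<lbrakk>u \<in> U; v \<in> U; w \<in> U\<rbrakk> \<Longrightarrow> u \<oplus> (v \<oplus> w) \<in> W"
proof -
  obtain A where A: "A \<in> \<U>" "\<And>u v. \<lbrakk>u \<in> A; v \<in> A\<rbrakk> \<Longrightarrow> u \<oplus> v \<in> W"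
    using base_oplus_refines assms by blast
  obtain B where B: "B \<in> \<U>" "\<And>u v. \<lbrakk>u \<in> B; v \<in> B\<rbrakk> \<Longrightarrow> u \<oplus> v \<in> A"
    using base_oplus_refines[of A] A(1) base_open base_zero by blast
  obtain U where U: "U \<in> \<U>" "U \<subseteq> A \<inter> B \<inter> W"
    using base_refines[of "A \<inter> B \<inter> W"] A(1) B(1) assms base_open base_zero
    by (auto simp: openin_Int)
  show thesis
  proof (rule that[OF U(1)])
    fix u v w
    assume "u \<in> U" "v \<in> U" "w \<in> U"
    with U(2) have "u \<in> A" "v \<in> B" "w \<in> B"
      by auto
    then show "u \<oplus> (v \<oplus> w) \<in> W"
      by (intro A(2) B(2))
  qed (use U(2) in blast)
qed

text \<open>Dependent choice: the next set is taken inside the current one and \<open>W n\<close>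
  together. \<open>U 0\<close> is an arbitrary base element, hence the shift by one in the inclusion
  into \<open>W n\<close>.\<close>

lemma base_sequence:
  fixes W :: "nat \<Rightarrow> 'a set"
  assumes "\<And>n. openin X (W n)" "\<And>n. zero \<in> W n"
  obtains U where "\<And>n. U n \<in> \<U>" "\<And>n. U (Suc n) \<subseteq> W n"
    "\<And>n u v w. \<lbrakk>u \<in> U (Suc n); v \<in> U (Suc n); w \<in> U (Suc n)\<rbrakk> \<Longrightarrow> u \<oplus> (v \<oplus> w) \<in> U n"
proof -
  have "\<exists>U. \<forall>n. U n \<in> \<U> \<and> (U (Suc n) \<subseteq> W n \<and>
      (\<forall>u\<in>U (Suc n). \<forall>v\<in>U (Suc n). \<forall>w\<in>U (Suc n). u \<oplus> (v \<oplus> w) \<in> U n))"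
  proof (rule dependent_nat_choice)
    show "\<exists>U. U \<in> \<U>"
      using base_refines assms by blast
    fix U n
    assume "U \<in> \<U>"
    then have "openin X (U \<inter> W n)" "zero \<in> U \<inter> W n"
      using assms base_open base_zero by auto
    then obtain U' where "U' \<in> \<U>" "U' \<subseteq> U \<inter> W n"
      "\<And>u v w. \<lbrakk>u \<in> U'; v \<in> U'; w \<in> U'\<rbrakk> \<Longrightarrow> u \<oplus> (v \<oplus> w) \<in> U \<inter> W n"
      by (rule base_oplus_refines3) iprover
    then show "\<exists>U'. U' \<in> \<U> \<and> (U' \<subseteq> W n \<and> (\<forall>u\<in>U'. \<forall>v\<in>U'. \<forall>w\<in>U'. u \<oplus> (v \<oplus> w) \<in> U))"
      by (intro exI[of _ U']) simp
  qed
  then obtain U where "\<forall>n. U n \<in> \<U> \<and> (U (Suc n) \<subseteq> W n \<and>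
      (\<forall>u\<in>U (Suc n). \<forall>v\<in>U (Suc n). \<forall>w\<in>U (Suc n). u \<oplus> (v \<oplus> w) \<in> U n))" ..
  then show thesis
    by (intro that[of U]) simp_all
qed

text \<open>The inverse of \<open>ominus y \<oplus> x\<close> is a gyration of
  \<open>ominus x \<oplus> y\<close>, so it stays in \<open>U\<close>; symmetry of \<open>U\<close>
  undoes the inversion.\<close>

lemma ominus_oplus_mem_sym:
  assumes "U \<in> \<U>" "x \<in> topspace X" "y \<in> topspace X" "ominus x \<oplus> y \<in> U"
  shows "ominus y \<oplus> x \<in> U"
proof -
  have "ominus (ominus y \<oplus> x) \<in> U"
    using ominus_ominus_oplus[of y x] base_gyr_closed[of U "ominus y" x] assms ominus_closed
    by simp
  then have "ominus (ominus (ominus y \<oplus> x)) \<in> U"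
    using base_symmetric[OF assms(1)] by blast
  then show ?thesis
    using assms by (simp add: ominus_ominus oplus_closed ominus_closed)
qed

text \<open>Telescope twice and distribute the outer gyration, a homomorphism, over the inner sum.
  The three terms are gyrated differences, still in \<open>U\<close>, bracketed as in
  \<open>base_sequence\<close>.\<close>

lemma ominus_oplus_mem_comp:
  assumes "U \<in> \<U>" "w \<in> topspace X" "x \<in> topspace X" "y \<in> topspace X" "z \<in> topspace X"
    and "ominus w \<oplus> x \<in> U" "ominus x \<oplus> y \<in> U" "ominus y \<oplus> z \<in> U"
  obtains a b c where "a \<in> U" "b \<in> U" "c \<in> U" "ominus w \<oplus> z = a \<oplus> (b \<oplus> c)"
proof -
  let ?g = "gyr (ominus w) x" and ?h = "gyr (ominus x) y"
  have "?g (ominus x \<oplus> y) \<in> U" "?g (?h (ominus y \<oplus> z)) \<in> U"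
    using assms by (auto intro!: base_gyr_closed ominus_closed)
  moreover have "ominus w \<oplus> z = (ominus w \<oplus> x) \<oplus> (?g (ominus x \<oplus> y) \<oplus> ?g (?h (ominus y \<oplus> z)))"
  proof -
    have "ominus w \<oplus> z = (ominus w \<oplus> x) \<oplus> ?g ((ominus x \<oplus> y) \<oplus> ?h (ominus y \<oplus> z))"
      using assms by (simp add: ominus_oplus_trans)
    also have "?g ((ominus x \<oplus> y) \<oplus> ?h (ominus y \<oplus> z))
        = ?g (ominus x \<oplus> y) \<oplus> ?g (?h (ominus y \<oplus> z))"
      using assms by (intro gyr_hom gyr_closed oplus_closed ominus_closed)
    finally show ?thesis .
  qed
  ultimately show thesis
    using that assms(6) by blast
qed

lemma openin_translate:
  assumes "openin X U" "x \<in> topspace X"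
  shows "openin X {y \<in> topspace X. ominus x \<oplus> y \<in> U}"
proof -
  have "continuous_map X (prod_topology X X) (\<lambda>y. (ominus x, y))"
    using assms(2) ominus_closed by (simp add: continuous_map_pairedI)
  then have "continuous_map X X ((\<lambda>(x, y). x \<oplus> y) \<circ> (\<lambda>y. (ominus x, y)))"
    using continuous_oplus by (rule continuous_map_compose)
  then show ?thesis
    using openin_continuous_map_preimage[OF _ assms(1)] by fastforce
qed

theorem submetrizable:
  assumes "countable_pseudocharacter X"
  shows "submetrizable_space X"
proof -
  obtain W :: "nat \<Rightarrow> 'a set" where W: "\<And>n. openin X (W n)" "(\<Inter>n. W n) = {zero}"
    using assms zero_closed unfolding countable_pseudocharacter_def by meson
  have "zero \<in> W n" for n
    using W(2) by blast
  with W(1) obtain U where U: "\<And>n. U n \<in> \<U>" "\<And>n. U (Suc n) \<subseteq> W n"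
    and U3: "\<And>n u v w. \<lbrakk>u \<in> U (Suc n); v \<in> U (Suc n); w \<in> U (Suc n)\<rbrakk> \<Longrightarrow> u \<oplus> (v \<oplus> w) \<in> U n"
    by (rule base_sequence) iprover
  define R where
    "R n = {(x, y). x \<in> topspace X \<and> y \<in> topspace X \<and> ominus x \<oplus> y \<in> U n}" for n
  have R_refl: "(x, x) \<in> R n" if "x \<in> topspace X" for x n
    using that U(1) base_zero by (simp add: R_def ominus_inverse)
  have R_comp: "R (Suc n) O R (Suc n) O R (Suc n) \<subseteq> R n" for n
  proof clarify
    fix w x y z
    assume "(w, x) \<in> R (Suc n)" "(x, y) \<in> R (Suc n)" "(y, z) \<in> R (Suc n)"
    then show "(w, z) \<in> R n"
      unfolding R_def by (auto elim!: ominus_oplus_mem_comp[OF U(1), of w x y z] intro: U3)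
  qed
  \<comment> \<open>These cover the triple composites in which one or two factors are the identity
    relation.\<close>
  have R_mono: "R (Suc n) O R (Suc n) \<subseteq> R n" "R (Suc n) \<subseteq> R n" for n
    using R_comp[of n] R_refl by (fastforce simp: R_def)+
  \<comment> \<open>The metrization lemma asks for reflexivity on the whole type, while
    \<open>R n\<close> is confined to the carrier. Adding \<open>Id\<close> relates each outside
    point to itself alone.\<close>
  define V where "V n = Id \<union> R n" for n
  have "(\<Inter>n. V n) \<subseteq> Id"
  proof clarify
    fix x y
    assume *: "(x, y) \<in> (\<Inter>n. V n)"
    show "x = y"
    proof (rule ccontr)
      assume "x \<noteq> y"
      with * have R: "(x, y) \<in> R n" for n
        by (auto simp: V_def)
      then have "ominus x \<oplus> y \<in> W n" for n
        using U(2)[of n] R[of "Suc n"] by (auto simp: R_def)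
      then have "ominus x \<oplus> y = zero"
        using W(2) by blast
      then show False
        using R[of 0] \<open>x \<noteq> y\<close> by (simp add: R_def ominus_oplus_eq_zero_iff)
    qed
  qed
  then have sep: "(\<Inter>n. V n) = Id"
    by (auto simp: V_def)
  have "(x, x) \<in> V n" for n x
    by (simp add: V_def)
  moreover have "sym (V n)" for n
    using ominus_oplus_mem_sym[OF U(1)] by (auto simp: sym_def V_def R_def)
  moreover have "V (Suc n) O V (Suc n) O V (Suc n) \<subseteq> V n" for n
    using R_comp[of n] R_mono[of n] unfolding V_def by blast
  ultimately obtain d where d: "Metric_space UNIV d"
    and V_d: "\<And>n x y. (x, y) \<in> V n \<Longrightarrow> d x y < (1/2) ^ n"
    using sep by (rule uniformity_metrization) iprover
  \<comment> \<open>The metric lives on the whole type and is cut down to the carrier.\<close>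
  interpret Metric_space "topspace X" d
    using d Metric_space.subspace by blast
  \<comment> \<open>The metric topology is coarser: each ball around \<open>x\<close> contains the
    translate of some \<open>U n\<close> to \<open>x\<close>, which is open in \<open>X\<close>. The
    identity is then the required continuous injection.\<close>
  have "openin X S" if S: "openin mtopology S" for S
  proof (subst openin_subopen, intro ballI)
    fix x
    assume "x \<in> S"
    then obtain r where r: "r > 0" "mball x r \<subseteq> S" and x: "x \<in> topspace X"
      using S unfolding openin_mtopology by blast
    obtain n where n: "(1/2) ^ n < r"
      using real_arch_pow_inv[OF r(1), of "1/2"] by auto
    let ?T = "{y \<in> topspace X. ominus x \<oplus> y \<in> U n}"
    have "openin X ?T"
      using openin_translate base_open U(1) x by blast
    moreover have "x \<in> ?T"
      using R_refl[OF x] by (simp add: R_def)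
    moreover have "?T \<subseteq> mball x r"
      using V_d[of x _ n] n x by (fastforce simp: V_def R_def)
    ultimately show "\<exists>T. openin X T \<and> x \<in> T \<and> T \<subseteq> S"
      using r(2) by blast
  qed
  then have "continuous_map X mtopology id"
    using topology_finer_continuous_id[of mtopology X] by auto
  with metrizable_space_mtopology show ?thesis
    by (rule submetrizable_spaceI) auto
qed

end

theorem theorem4p3:
  fixes X :: "'a topology"
    and oplus :: "'a \<Rightarrow> 'a \<Rightarrow> 'a"
    and zero :: 'a
    and ominus :: "'a \<Rightarrow> 'a"
    and gyr :: "'a \<Rightarrow> 'a \<Rightarrow> 'a \<Rightarrow> 'a"
    and \<U> :: "'a set set"
  assumes "strongly_topological_gyrogroup X oplus zero ominus gyr \<U>"
    and "t0_space X"
    and "countable_pseudocharacter X"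
  shows "submetrizable_space X"
  using strongly_topological_gyrogroup.submetrizable[OF assms(1,3)] .

end
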